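(* Let $0<q<1$ and let $B^{(r)}_{n,q}(x)$, $B^{(r)}_{n,q}$ and $E^{(r)}_{k,q}(x)$ be as defined in the context. Then for all integers $n,r \geq 0$, $$B_{n,q}^{(r)}(x)=\frac{1}{2^r}\sum_{k=0}^{n} \Bigg\{ \sum_{m=0}^{n-k}\sum_{l=0}^{r} \sum_{\substack{i_1+ \cdots +i_l=m\\ i_1,\dots,i_l\ge0}}\binom{r}{l}\binom{m}{i_1, \cdots , i_l}_q \binom{m+k}{m}_q \binom{n}{m+k}_q B_{n-m-k,q}^{(r)} \Bigg\} E_{k,q}^{(r)}(x),$$ where $\binom{m}{i_1, \cdots , i_l}_q=\frac{[m]_q!}{[i_1]_q!\cdots[i_l]_q!}$.
   Context: Fix a real number $q$ with $0<q<1$. For an integer $n\ge 0$ set $[n]_q=\frac{1-q^n}{1-q}$, $[0]_q!=1$, $[n]_q!=[1]_q\cdots[n]_q$, and $\binom{n}{k}_q=\frac{[n]_q!}{[k]_q![n-k]_q!}$ for $0\le k\le n$. Let $e_q(z)=\sum_{n=0}^{\infty}\frac{z^n}{[n]_q!}$. For an integer $r\ge0$, the $q$-Euler polynomials of order $r$ are defined by the formal power series identity $\left(\frac{2}{e_q(t)+1}\right)^r e_q(xt)=\sum_{n\ge0}E^{(r)}_{n,q}(x)\frac{t^n}{[n]_q!}$, and the $q$-Bernoulli polynomials of order $r$ by $\left(\frac{t}{e_q(t)-1}\right)^r e_q(xt)=\sum_{n\ge0}B^{(r)}_{n,q}(x)\frac{t^n}{[n]_q!}$, with $B^{(r)}_{n,q}=B^{(r)}_{n,q}(0)$.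 For $l=0$ the sum over $i_1+\cdots+i_0=m$ is understood as $1$ if $m=0$ and $0$ otherwise. *)

theory Defs
  imports Complex_Main "HOL-Computational_Algebra.Formal_Power_Series"
begin

definition q_int :: "real \<Rightarrow> nat \<Rightarrow> real" where
  "q_int q n = (1 - q ^ n) / (1 - q)"

definition q_fact :: "real \<Rightarrow> nat \<Rightarrow> real" where
  "q_fact q n = (\<Prod>j = 1..n. q_int q j)"

text \<open>Only meaningful for \<open>k \<le> n\<close>, because of the truncated subtraction.\<close>

definition q_binomial :: "real \<Rightarrow> nat \<Rightarrow> nat \<Rightarrow> real" where
  "q_binomial q n k = q_fact q n / (q_fact q k * q_fact q (n - k))"

definition q_multinomial :: "real \<Rightarrow> nat \<Rightarrow> nat list \<Rightarrow> real" where
  "q_multinomial q m js = q_fact q m / (\<Prod>j\<leftarrow>js. q_fact q j)"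

text \<open>
  The parameter \<open>q\<close> is real; the argument \<open>x\<close> of the polynomials ranges over an arbitrary
  field extension of the reals, so that real and complex arguments are both covered.
\<close>

definition q_exp :: "real \<Rightarrow> 'a::real_field fps" where
  "q_exp q = Abs_fps (\<lambda>n. 1 / of_real (q_fact q n))"

text \<open>\<open>q_exp q oo (fps_const x * fps_X)\<close> is the series \<open>e\<^sub>q(xt)\<close> in the variable \<open>t\<close>.\<close>

definition q_euler_gf :: "real \<Rightarrow> nat \<Rightarrow> 'a::real_field \<Rightarrow> 'a fps" where
  "q_euler_gf q r x = (2 / (q_exp q + 1)) ^ r * (q_exp q oo (fps_const x * fps_X))"

text \<open>
  The constant term of \<open>q_exp q - 1\<close> vanishes; for \<open>0 < q < 1\<close> the quotient below is nevertheless
  an exact one of formal power series (lemma \<open>q_bernoulli_quotient\<close>).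
\<close>

definition q_bernoulli_gf :: "real \<Rightarrow> nat \<Rightarrow> 'a::real_field \<Rightarrow> 'a fps" where
  "q_bernoulli_gf q r x = (fps_X / (q_exp q - 1)) ^ r * (q_exp q oo (fps_const x * fps_X))"

definition q_euler :: "real \<Rightarrow> nat \<Rightarrow> nat \<Rightarrow> 'a::real_field \<Rightarrow> 'a" where
  "q_euler q r n x = of_real (q_fact q n) * fps_nth (q_euler_gf q r x) n"

definition q_bernoulli :: "real \<Rightarrow> nat \<Rightarrow> nat \<Rightarrow> 'a::real_field \<Rightarrow> 'a" where
  "q_bernoulli q r n x = of_real (q_fact q n) * fps_nth (q_bernoulli_gf q r x) n"

lemma q_fact_pos:
  assumes "0 < q" "q < 1"
  shows "q_fact q n > 0"
  unfolding q_fact_def q_int_def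
  using assms by (intro prod_pos) (auto intro!: divide_pos_pos simp: power_less_one_iff)

lemma q_euler_quotient:
  "2 / (q_exp q + 1) * (q_exp q + 1) = (2 :: 'a::real_field fps)"
proof -
  have "fps_nth (q_exp q + 1 :: 'a fps) 0 \<noteq> 0"
    by (simp add: q_exp_def q_fact_def)
  then show ?thesis
    by (simp add: fps_divide_unit mult.assoc inverse_mult_eq_1)
qed

lemma q_bernoulli_quotient:
  assumes "0 < q" "q < 1"
  shows "fps_X / (q_exp q - 1) * (q_exp q - 1) = (fps_X :: 'a::real_field fps)"
proof -
  let ?f = "q_exp q - 1 :: 'a fps"
  have nth0: "fps_nth ?f 0 = 0" and nth1: "fps_nth ?f 1 \<noteq> 0"
    using assms by (simp_all add: q_exp_def q_fact_def q_int_def)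
  then have "subdegree ?f = 1"
    by (intro subdegreeI) auto
  moreover have "?f \<noteq> 0"
    using nth1 by auto
  ultimately have "?f dvd fps_X"
    by (subst fps_dvd_iff) auto
  then show ?thesis
    by simp
qed

lemma q_euler_gf_eq:
  assumes "0 < q" "q < 1"
  shows "q_euler_gf q r x = Abs_fps (\<lambda>n. q_euler q r n x / of_real (q_fact q n))"
  using q_fact_pos[OF assms] by (simp add: fps_eq_iff q_euler_def less_le)

lemma q_bernoulli_gf_eq:
  assumes "0 < q" "q < 1"
  shows "q_bernoulli_gf q r x = Abs_fps (\<lambda>n. q_bernoulli q r n x / of_real (q_fact q n))"
  using q_fact_pos[OF assms] by (simp add: fps_eq_iff q_bernoulli_def less_le)

end

theory Submission
  imports Defs
begin

text \<open>
  Writing \<open>e = e\<^sub>q(t)\<close>, the Bernoulli generating function factors as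
  \<open>(t / (e - 1))\<^sup>r e\<^sub>q(xt) = 2\<^sup>-\<^sup>r (e + 1)\<^sup>r \<cdot> (t / (e - 1))\<^sup>r \<cdot> (2 / (e + 1))\<^sup>r e\<^sub>q(xt)\<close>.
  Expanding \<open>(e + 1)\<^sup>r\<close> by the binomial theorem and comparing the coefficients of \<open>t\<^sup>n\<close>
  gives the identity.
\<close>

text \<open>For positive \<open>l\<close> this is the \<open>natpermute\<close> expansion of a
  power. For \<open>l = 0\<close> only the empty list occurs, which yields the convention for the
  empty sum.\<close>

lemma fps_power_nth_prod_list:
  fixes a :: "'a::comm_ring_1 fps"
  shows "fps_nth (a ^ l) m =
    (\<Sum>js \<in> {js :: nat list. length js = l \<and> sum_list js = m}. \<Prod>j\<leftarrow>js. fps_nth a j)"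
proof (cases l)
  case 0
  have "{js :: nat list. js = [] \<and> m = 0} = (if m = 0 then {[]} else {})"
    by auto
  moreover have "{js :: nat list. length js = 0 \<and> sum_list js = m} = {js. js = [] \<and> m = 0}"
    by auto
  ultimately show ?thesis
    using 0 by simp
next
  case (Suc k)
  then show ?thesis
    unfolding fps_power_nth_Suc natpermute_def Suc
    by (intro sum.cong)
      (auto simp: prod.list_conv_set_nth atLeastLessThanSuc_atLeastAtMost simp flip: atLeast0LessThan)
qed

lemma q_bernoulli_gf_factor:
  "fps_const (2 ^ r) * q_bernoulli_gf q r x =
    q_euler_gf q r x * ((q_exp q + 1) ^ r * q_bernoulli_gf q r (0::'a::real_field))"
proof -
  \<comment> \<open>At \<open>x = 0\<close> the factor
    \<open>q_exp q oo (fps_const x * fps_X)\<close> collapses to its constant term 1.\<close>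
  have gf0: "q_bernoulli_gf q r 0 = (fps_X / (q_exp q - 1 :: 'a fps)) ^ r"
    by (simp add: q_bernoulli_gf_def q_exp_def q_fact_def fps_compose_0_right)
  have "fps_const (2 ^ r) = (2 / (q_exp q + 1) * (q_exp q + 1 :: 'a fps)) ^ r"
    by (simp only: q_euler_quotient) (simp add: numeral_fps_const)
  then show ?thesis
    unfolding gf0 by (simp add: q_bernoulli_gf_def q_euler_gf_def power_mult_distrib mult_ac)
qed

text \<open>The binomial theorem reduces this to the powers of \<open>q_exp q\<close>, whose
  coefficients are sums over lists of length \<open>l\<close>.\<close>

lemma q_exp_add_1_power_nth:
  "fps_nth ((q_exp q + 1 :: 'a::real_field fps) ^ r) m =
    (\<Sum>l = 0..r. \<Sum>js \<in> {js :: nat list. length js = l \<and> sum_list js = m}.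
      of_nat (r choose l) * inverse (of_real (\<Prod>j\<leftarrow>js. q_fact q j)))"
proof -
  have "(\<Prod>j\<leftarrow>js. fps_nth (q_exp q) j) = (inverse (of_real (\<Prod>j\<leftarrow>js. q_fact q j)) :: 'a)" for js
    by (induction js) (simp_all add: q_exp_def field_simps)
  moreover have "fps_nth (of_nat c * f) m = of_nat c * fps_nth f m" for c and f :: "'a fps"
    by (simp flip: fps_of_nat)
  ultimately show ?thesis
    by (simp add: binomial_ring fps_sum_nth fps_power_nth_prod_list sum_distrib_left atLeast0AtMost)
qed

theorem theorem9:
  fixes q :: real and n r :: nat and x :: "'a::real_field"
  assumes "0 < q" and "q < 1"
  shows "q_bernoulli q r n x =
    1 / 2 ^ r *
    (\<Sum>k = 0..n.
      (\<Sum>m = 0..n - k. \<Sum>l = 0..r. \<Sum>js \<in> {js :: nat list. length js = l \<and> sum_list js = m}.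
        of_nat (r choose l) * of_real (q_multinomial q m js)
        * of_real (q_binomial q (m + k) m) * of_real (q_binomial q n (m + k))
        * q_bernoulli q r (n - m - k) 0)
      * q_euler q r k x)"
proof -
  have nz: "q_fact q i \<noteq> 0" for i
    using q_fact_pos[OF assms, of i] by simp
  \<comment> \<open>The factorials of \<open>m\<close> and \<open>m + k\<close> cancel among the
    q-coefficients; those of \<open>k\<close> and \<open>n - m - k\<close> cancel against the
    normalisations of \<open>q_euler\<close> and \<open>q_bernoulli\<close>.\<close>
  have summand: "of_nat c * of_real (q_multinomial q m js)
        * of_real (q_binomial q (m + k) m) * of_real (q_binomial q n (m + k))
        * q_bernoulli q r (n - m - k) 0 * q_euler q r k x
      = of_real (q_fact q n) * (fps_nth (q_euler_gf q r x) k *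
          (of_nat c * inverse (of_real (\<Prod>j\<leftarrow>js. q_fact q j))
           * fps_nth (q_bernoulli_gf q r (0::'a)) (n - k - m)))" for c m js k
  proof -
    have "n - (m + k) = n - m - k" "n - k - m = n - m - k"
      by simp_all
    then show ?thesis
      using nz by (simp add: q_multinomial_def q_binomial_def q_bernoulli_def q_euler_def divide_simps)
  qed
  have "2 ^ r * q_bernoulli q r n x =
      of_real (q_fact q n) * fps_nth (fps_const (2 ^ r) * q_bernoulli_gf q r x) n"
    by (simp add: q_bernoulli_def)
  also have "\<dots> = (\<Sum>k = 0..n.
      (\<Sum>m = 0..n - k. \<Sum>l = 0..r. \<Sum>js \<in> {js :: nat list. length js = l \<and> sum_list js = m}.
        of_nat (r choose l) * of_real (q_multinomial q m js)
        * of_real (q_binomial q (m + k) m) * of_real (q_binomial q n (m + k))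
        * q_bernoulli q r (n - m - k) 0)
      * q_euler q r k x)"
    \<comment> \<open>Two nested Cauchy products: \<open>k\<close> indexes the Euler series and
      \<open>m\<close> the power of \<open>q_exp q + 1\<close>, leaving \<open>n - k - m\<close> for
      the Bernoulli series at 0.\<close>
    unfolding q_bernoulli_gf_factor fps_mult_nth q_exp_add_1_power_nth
      sum_distrib_left sum_distrib_right summand ..
  finally show ?thesis
    by (simp add: field_simps)
qed

end
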